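(* Let $H$ be an infinite dimensional separable Hilbert space and $I$ a countable index set. Let $w=\{w_j\}_{j\in I}$ be a frame sequence in $H$, $f=\{f_i\}_{i\in I}$ a frame for $H$, and $u=\{u_i\}_{i\in I}$, $v=\{v_i\}_{i\in I}$ Parseval frames for $H$. Let $\widetilde w=\{\widetilde w_j\}_{j\in I}$ be the canonical dual of $w$ and let $y=\{y_i\}_{i\in I}$ be the sequence in $\overline{span}\{w_j\}_{j\in I}$ defined by $y_i:=\sum_{k\in I}\langle u_k,f_i\rangle\widetilde w_k$, $i\in I$. Then $w$ is a weak R-dual of $f$ with respect to $u$ and $v$ if and only if the following two conditions hold: (i) $(G(\widetilde w,w)^t-\mathcal I)G(u,f)=\mathbf 0$, i.e. $\sum_{k\in I}\langle\widetilde w_k,w_j\rangle\langle u_k,f_i\rangle=\langle u_j,f_i\rangle$ for all $i,j\in I$; (ii) for every $i\in I$, $v_i=y_i+x_i$ for some $x_i\in(span\{w_j\}_{j\in I})^\perp$.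
   Context: Inner products are linear in the first variable. A sequence $\{f_i\}_{i\in I}$ in $H$ is a frame for $H$ if there are $0<A\le B<\infty$ with $A\|x\|^2\le\sum_{i}|\langle x,f_i\rangle|^2\le B\|x\|^2$ for all $x\in H$; it is a Parseval frame if one can take $A=B=1$. A sequence is a frame sequence if it is a frame for its closed linear span. The canonical dual of a frame sequence $w$ is $\widetilde w_j=S_w^{-1}w_j$, where $S_w g=\sum_j\langle g,w_j\rangle w_j$ is the frame operator of $w$ on $\overline{span}\{w_j\}$. For sequences $g,h$ in $H$ indexed by $I$, $G(g,h)$ denotes the matrix $(\langle g_i,h_j\rangle)_{i,j\in I}$, $G(g,h)^t$ its transpose, and $\mathcal I$ the infinite identity matrix. Weak R-dual: let $u,v$ be Parseval frames for $H$ and $f$ a sequence in $H$ such that $\sum_{i\in I}|\langle f_i,u_j\rangle|^2<\infty$ for all $j\in I$ and $(G(v,v)^t-\mathcal I)G(f,u)=\mathbf 0$ (i.e. $\sum_{k}\langle v_k,v_i\rangle\langle f_k,u_j\rangle=\langle f_i,u_j\rangle$ for all $i,j$). Then the sequence $w=\{w_j\}_{j\in I}$ given by $w_j=\sum_{i\in I}\langle f_i,u_j\rangle v_i$ is called the weak R-dual of $f$ with respect to $u$ and $v$. (So "$w$ is a weak R-dual of $f$ with respect to $u$ and $v$" means that all these conditions hold.) *)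

theory Defs
  imports "HOL-Analysis.Analysis"
begin

section \<open>Complex Hilbert spaces\<close>

text \<open>
  The inner product is linear in its first argument. Since every space is also a
  \<^class>\<open>real_normed_vector\<close>, positive definiteness and \<open>\<parallel>x\<parallel> = sqrt \<langle>x, x\<rangle>\<close> are both expressed by the
  single axiom \<open>cinner_self\<close>, and \<open>scaleC_of_real\<close> makes the two scalar multiplications agree.
\<close>

class complex_inner = real_normed_vector +
  fixes scaleC :: "complex \<Rightarrow> 'a \<Rightarrow> 'a" (infixr "*\<^sub>C" 75)
    and cinner :: "'a \<Rightarrow> 'a \<Rightarrow> complex"
  assumes scaleC_add_right: "a *\<^sub>C (x + y) = a *\<^sub>C x + a *\<^sub>C y"
    and scaleC_add_left: "(a + b) *\<^sub>C x = a *\<^sub>C x + b *\<^sub>C x"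
    and scaleC_scaleC: "a *\<^sub>C (b *\<^sub>C x) = (a * b) *\<^sub>C x"
    and scaleC_one: "1 *\<^sub>C x = x"
    and scaleC_of_real: "complex_of_real r *\<^sub>C x = r *\<^sub>R x"
    and cinner_add_left: "cinner (x + y) z = cinner x z + cinner y z"
    and cinner_scaleC_left: "cinner (a *\<^sub>C x) y = a * cinner x y"
    and cinner_commute: "cinner x y = cnj (cinner y x)"
    and cinner_self: "cinner x x = complex_of_real ((norm x)\<^sup>2)"

class chilbert_space = complex_inner + complete_space

instantiation complex :: chilbert_space
begin

definition scaleC_complex :: "complex \<Rightarrow> complex \<Rightarrow> complex"
  where "scaleC_complex a x = a * x"

definition cinner_complex :: "complex \<Rightarrow> complex \<Rightarrow> complex"
  where "cinner_complex x y = x * cnj y"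

instance
  by standard
    (auto simp: scaleC_complex_def cinner_complex_def algebra_simps scaleR_conv_of_real
      complex_norm_square[symmetric])

end

global_interpretation complex_vector:
  vector_space "scaleC :: complex \<Rightarrow> 'a \<Rightarrow> 'a::complex_inner"
  defines cspan = complex_vector.span
  by unfold_locales
    (simp_all add: scaleC_add_right scaleC_add_left scaleC_scaleC scaleC_one)

definition infinite_cdim :: "'a::complex_inner itself \<Rightarrow> bool"
  where "infinite_cdim _ \<longleftrightarrow> \<not> (\<exists>B :: 'a set. finite B \<and> cspan B = UNIV)"

definition closed_cspan :: "'a::complex_inner set \<Rightarrow> 'a set"
  where "closed_cspan S = closure (cspan S)"

definition orth_compl :: "'a::complex_inner set \<Rightarrow> 'a set"
  where "orth_compl S = {x. \<forall>s\<in>S. cinner x s = 0}"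


section \<open>Frames\<close>

text \<open>
  A sequence indexed by \<open>I\<close> is a function on the index type; only its values on \<open>I\<close> matter.
  \<^const>\<open>infsum\<close> is \<open>0\<close> on families that are not summable, so summability is demanded explicitly.
\<close>

definition frame_with_bounds ::
    "'i set \<Rightarrow> ('i \<Rightarrow> 'a::complex_inner) \<Rightarrow> 'a set \<Rightarrow> real \<Rightarrow> real \<Rightarrow> bool"
  where "frame_with_bounds I f K A B \<longleftrightarrow>
    (\<forall>i\<in>I. f i \<in> K) \<and> 0 < A \<and> A \<le> B \<and>
    (\<forall>x\<in>K. (\<lambda>i. (cmod (cinner x (f i)))\<^sup>2) summable_on I \<and>
      A * (norm x)\<^sup>2 \<le> (\<Sum>\<^sub>\<infinity>i\<in>I. (cmod (cinner x (f i)))\<^sup>2) \<and>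
      (\<Sum>\<^sub>\<infinity>i\<in>I. (cmod (cinner x (f i)))\<^sup>2) \<le> B * (norm x)\<^sup>2)"

definition frame_for :: "'i set \<Rightarrow> ('i \<Rightarrow> 'a::complex_inner) \<Rightarrow> 'a set \<Rightarrow> bool"
  where "frame_for I f K \<longleftrightarrow> (\<exists>A B. frame_with_bounds I f K A B)"

definition parseval_frame_for :: "'i set \<Rightarrow> ('i \<Rightarrow> 'a::complex_inner) \<Rightarrow> 'a set \<Rightarrow> bool"
  where "parseval_frame_for I f K \<longleftrightarrow> frame_with_bounds I f K 1 1"

definition frame_sequence :: "'i set \<Rightarrow> ('i \<Rightarrow> 'a::complex_inner) \<Rightarrow> bool"
  where "frame_sequence I w \<longleftrightarrow> frame_for I w (closed_cspan (w ` I))"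

definition frame_operator :: "'i set \<Rightarrow> ('i \<Rightarrow> 'a::complex_inner) \<Rightarrow> 'a \<Rightarrow> 'a"
  where "frame_operator I w g = (\<Sum>\<^sub>\<infinity>j\<in>I. cinner g (w j) *\<^sub>C w j)"

text \<open>The frame operator is inverted as a map on the closed linear span of the sequence.\<close>

definition canonical_dual :: "'i set \<Rightarrow> ('i \<Rightarrow> 'a::complex_inner) \<Rightarrow> 'i \<Rightarrow> 'a"
  where "canonical_dual I w j = inv_into (closed_cspan (w ` I)) (frame_operator I w) (w j)"


section \<open>Infinite matrices and weak R-duals\<close>

definition cross_gram ::
    "('i \<Rightarrow> 'a::complex_inner) \<Rightarrow> ('i \<Rightarrow> 'a) \<Rightarrow> 'i \<Rightarrow> 'i \<Rightarrow> complex"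
  where "cross_gram g h i j = cinner (g i) (h j)"

definition mat_transpose :: "('i \<Rightarrow> 'i \<Rightarrow> complex) \<Rightarrow> 'i \<Rightarrow> 'i \<Rightarrow> complex"
  where "mat_transpose M i j = M j i"

definition mat_id :: "'i \<Rightarrow> 'i \<Rightarrow> complex"
  where "mat_id i j = (if i = j then 1 else 0)"

definition mat_diff ::
    "('i \<Rightarrow> 'i \<Rightarrow> complex) \<Rightarrow> ('i \<Rightarrow> 'i \<Rightarrow> complex) \<Rightarrow> 'i \<Rightarrow> 'i \<Rightarrow> complex"
  where "mat_diff M N i j = M i j - N i j"

text \<open>
  The product of the \<open>I \<times> I\<close> matrices \<open>M\<close> and \<open>N\<close> is the zero matrix; each of the series defining
  its entries is required to converge.
\<close>

definition mat_prod_eq_zero ::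
    "'i set \<Rightarrow> ('i \<Rightarrow> 'i \<Rightarrow> complex) \<Rightarrow> ('i \<Rightarrow> 'i \<Rightarrow> complex) \<Rightarrow> bool"
  where "mat_prod_eq_zero I M N \<longleftrightarrow> (\<forall>i\<in>I. \<forall>j\<in>I. ((\<lambda>k. M i k * N k j) has_sum 0) I)"

definition weak_R_dual ::
    "'i set \<Rightarrow> ('i \<Rightarrow> 'a::complex_inner) \<Rightarrow> ('i \<Rightarrow> 'a) \<Rightarrow> ('i \<Rightarrow> 'a) \<Rightarrow> ('i \<Rightarrow> 'a) \<Rightarrow> bool"
  where "weak_R_dual I f u v w \<longleftrightarrow>
    parseval_frame_for I u UNIV \<and> parseval_frame_for I v UNIV \<and>
    (\<forall>j\<in>I. (\<lambda>i. (cmod (cinner (f i) (u j)))\<^sup>2) summable_on I) \<and>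
    mat_prod_eq_zero I (mat_diff (mat_transpose (cross_gram v v)) mat_id) (cross_gram f u) \<and>
    (\<forall>j\<in>I. ((\<lambda>i. cinner (f i) (u j) *\<^sub>C v i) has_sum w j) I)"

end

theory Submission
  imports Defs
begin

text \<open>
  Since \<open>v\<close> is Parseval, \<open>w\<close> is a weak R-dual iff \<open>\<langle>w\<^sub>j, v\<^sub>i\<rangle> = \<langle>f\<^sub>i, u\<^sub>j\<rangle>\<close> for all \<open>i, j\<close>: the series
  defining \<open>w\<^sub>j\<close> is then the Parseval reconstruction of \<open>w\<^sub>j\<close>, and the Gram condition is its inner
  product with \<open>v\<^sub>i\<close>. If these identities hold, then \<open>y\<^sub>i = \<Sum> \<langle>v\<^sub>i, w\<^sub>k\<rangle> S\<^sup>-\<^sup>1 w\<^sub>k\<close> is the orthogonal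
  projection of \<open>v\<^sub>i\<close> onto the closed span of \<open>w\<close>, which gives (ii), and pairing with \<open>w\<^sub>j\<close> gives (i).
  Conversely, (i) says \<open>\<langle>y\<^sub>i, w\<^sub>j\<rangle> = \<langle>u\<^sub>j, f\<^sub>i\<rangle>\<close>, and by (ii) \<open>v\<^sub>i\<close> may replace \<open>y\<^sub>i\<close>.
\<close>

section \<open>Complex inner products\<close>

lemma cinner_add_right: "cinner x (y + z) = cinner x y + cinner x z"
  for x y z :: "'a::complex_inner"
  by (metis cinner_add_left cinner_commute complex_cnj_add)

lemma cinner_scaleC_right: "cinner x (a *\<^sub>C y) = cnj a * cinner x y"
  for x y :: "'a::complex_inner"
  by (metis cinner_scaleC_left cinner_commute complex_cnj_mult)

lemma scaleC_minus_one: "(-1) *\<^sub>C x = - x"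
  for x :: "'a::complex_inner"
  using scaleC_of_real[of "-1" x] by simp

lemma cinner_minus_left: "cinner (- x) y = - cinner x y"
  for x y :: "'a::complex_inner"
  using cinner_scaleC_left[of "-1" x y] by (simp add: scaleC_minus_one)

lemma cinner_minus_right: "cinner x (- y) = - cinner x y"
  for x y :: "'a::complex_inner"
  using cinner_scaleC_right[of x "-1" y] by (simp add: scaleC_minus_one)

lemma cinner_diff_left: "cinner (x - y) z = cinner x z - cinner y z"
  for x y z :: "'a::complex_inner"
  using cinner_add_left[of x "- y" z] by (simp add: cinner_minus_left)

lemma cinner_diff_right: "cinner x (y - z) = cinner x y - cinner x z"
  for x y z :: "'a::complex_inner"
  using cinner_add_right[of x y "- z"] by (simp add: cinner_minus_right)

lemma cinner_zero_left [simp]: "cinner 0 x = 0"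
  for x :: "'a::complex_inner"
  using cinner_diff_left[of x x x] by simp

lemma cinner_zero_right [simp]: "cinner x 0 = 0"
  for x :: "'a::complex_inner"
  using cinner_diff_right[of x x x] by simp

lemma cinner_scaleR_left: "cinner (r *\<^sub>R x) y = r *\<^sub>R cinner x y"
  for x y :: "'a::complex_inner"
  using cinner_scaleC_left[of "complex_of_real r" x y]
  by (simp add: scaleC_of_real scaleR_conv_of_real)

lemma cinner_scaleR_right: "cinner x (r *\<^sub>R y) = r *\<^sub>R cinner x y"
  for x y :: "'a::complex_inner"
  using cinner_scaleC_right[of x "complex_of_real r" y]
  by (simp add: scaleC_of_real scaleR_conv_of_real)

lemma cinner_sum_left: "cinner (\<Sum>i\<in>F. g i) x = (\<Sum>i\<in>F. cinner (g i) x)"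
  for x :: "'a::complex_inner"
  by (induction F rule: infinite_finite_induct) (auto simp: cinner_add_left)

lemma cmod_cinner_commute: "cmod (cinner x y) = cmod (cinner y x)"
  for x y :: "'a::complex_inner"
  by (metis cinner_commute complex_mod_cnj)

lemma norm_scaleC: "norm (a *\<^sub>C x) = cmod a * norm x"
  for x :: "'a::complex_inner"
proof -
  have "cinner (a *\<^sub>C x) (a *\<^sub>C x) = (a * cnj a) * cinner x x"
    by (simp add: cinner_scaleC_left cinner_scaleC_right)
  then have "complex_of_real ((norm (a *\<^sub>C x))\<^sup>2) = complex_of_real ((cmod a * norm x)\<^sup>2)"
    unfolding cinner_self complex_norm_square[symmetric] power_mult_distrib of_real_mult .
  then have "(norm (a *\<^sub>C x))\<^sup>2 = (cmod a * norm x)\<^sup>2"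
    using of_real_eq_iff by blast
  then show ?thesis
    by simp
qed

lemma norm_diff_square: "(norm (x - y))\<^sup>2 = (norm x)\<^sup>2 - 2 * Re (cinner x y) + (norm y)\<^sup>2"
  for x y :: "'a::complex_inner"
proof -
  have "complex_of_real ((norm (x - y))\<^sup>2) =
      of_real ((norm x)\<^sup>2) - (cinner x y + cnj (cinner x y)) + of_real ((norm y)\<^sup>2)"
    unfolding cinner_self[symmetric] using cinner_commute[of y x]
    by (simp add: cinner_diff_left cinner_diff_right)
  then show ?thesis
    unfolding complex_add_cnj by (metis of_real_add of_real_diff of_real_eq_iff)
qed

text \<open>The square norm of the component of \<open>x\<close> orthogonal to \<open>y\<close> is
  nonnegative. That component is multiplied by \<open>(norm y)\<^sup>2\<close>, which avoids
  dividing by it before the last step.\<close>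

lemma cinner_Cauchy_Schwarz: "cmod (cinner x y) \<le> norm x * norm y"
  for x y :: "'a::complex_inner"
proof (cases "y = 0")
  case False
  define p where "p = cinner x y"
  have "Re (cinner ((norm y)\<^sup>2 *\<^sub>R x) (p *\<^sub>C y)) = (norm y)\<^sup>2 * (cmod p)\<^sup>2"
    by (simp add: cinner_scaleR_left cinner_scaleC_right p_def[symmetric] cmod_power2
        power2_eq_square[of "Re p"] power2_eq_square[of "Im p"])
  then have "0 \<le> ((norm y)\<^sup>2 * norm x)\<^sup>2 - 2 * ((norm y)\<^sup>2 * (cmod p)\<^sup>2) + (cmod p * norm y)\<^sup>2"
    using norm_diff_square[of "(norm y)\<^sup>2 *\<^sub>R x" "p *\<^sub>C y"]
      zero_le_power2[of "norm ((norm y)\<^sup>2 *\<^sub>R x - p *\<^sub>C y)"]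
    by (simp add: norm_scaleC)
  also have "\<dots> = (norm y)\<^sup>2 * ((norm x * norm y)\<^sup>2 - (cmod p)\<^sup>2)"
    by (simp add: power2_eq_square algebra_simps)
  finally have "(cmod p)\<^sup>2 \<le> (norm x * norm y)\<^sup>2"
    using False by (simp add: zero_le_mult_iff)
  then show ?thesis
    unfolding p_def by (simp add: abs_le_square_iff[symmetric])
qed simp

lemma bounded_linear_cinner_left: "bounded_linear (\<lambda>x. cinner x y)"
  for y :: "'a::complex_inner"
  by (rule bounded_linear_intro[where K = "norm y"])
    (auto simp: cinner_add_left cinner_scaleR_left cinner_Cauchy_Schwarz)

lemma bounded_linear_scaleC: "bounded_linear (\<lambda>x :: 'a::complex_inner. a *\<^sub>C x)"
proof (rule bounded_linear_intro[where K = "cmod a"])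
  show "a *\<^sub>C (r *\<^sub>R x) = r *\<^sub>R (a *\<^sub>C x)" for r and x :: 'a
    by (simp add: scaleC_of_real[symmetric] scaleC_scaleC mult.commute)
qed (auto simp: scaleC_add_right norm_scaleC mult.commute)

lemma has_sum_cinner:
  fixes g :: "'i \<Rightarrow> 'a::complex_inner"
  assumes "((\<lambda>k. c k *\<^sub>C g k) has_sum z) I"
  shows "((\<lambda>k. c k * cinner (g k) x) has_sum cinner z x) I"
  using has_sum_bounded_linear[OF bounded_linear_cinner_left assms, of x]
  by (simp add: cinner_scaleC_left)

section \<open>Orthogonality to spans and closed spans\<close>

lemma orth_compl_cspan: "x \<in> orth_compl (cspan S) \<longleftrightarrow> (\<forall>s\<in>S. cinner x s = 0)"
  for x :: "'a::complex_inner"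
proof
  assume orth: "\<forall>s\<in>S. cinner x s = 0"
  have "cinner x z = 0" if "z \<in> cspan S" for z
    using that
    by (induction rule: complex_vector.span_induct_alt)
      (auto simp: cinner_add_right cinner_scaleC_right orth)
  then show "x \<in> orth_compl (cspan S)"
    by (simp add: orth_compl_def)
qed (auto simp: orth_compl_def complex_vector.span_base)

lemma closed_cspan_add:
  assumes "x \<in> closed_cspan S" and "y \<in> closed_cspan S"
  shows "x + y \<in> closed_cspan S"
proof -
  obtain a b where "\<And>n. a n \<in> cspan S" "a \<longlonglongrightarrow> x" "\<And>n. b n \<in> cspan S" "b \<longlonglongrightarrow> y"
    using assms by (auto simp: closed_cspan_def closure_sequential)
  then have "\<forall>n. a n + b n \<in> cspan S" "(\<lambda>n. a n + b n) \<longlonglongrightarrow> x + y"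
    by (auto intro: complex_vector.span_add tendsto_add)
  then show ?thesis
    unfolding closed_cspan_def closure_sequential by (intro exI conjI)
qed

lemma closed_cspan_scaleC:
  assumes "x \<in> closed_cspan S"
  shows "c *\<^sub>C x \<in> closed_cspan S"
proof -
  obtain a where "\<And>n. a n \<in> cspan S" "a \<longlonglongrightarrow> x"
    using assms by (auto simp: closed_cspan_def closure_sequential)
  then have "\<forall>n. c *\<^sub>C a n \<in> cspan S" "(\<lambda>n. c *\<^sub>C a n) \<longlonglongrightarrow> c *\<^sub>C x"
    by (auto intro: complex_vector.span_scale bounded_linear.tendsto[OF bounded_linear_scaleC])
  then show ?thesis
    unfolding closed_cspan_def closure_sequential by (intro exI conjI)
qed


section \<open>Unconditional convergence\<close>

text \<open>A Cauchy criterion: applied to \<open>F - F0\<close>, the hypothesis bounds a block of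
  the vector series by a block of the convergent scalar series. Completeness then supplies the
  limit.\<close>

lemma summable_on_square_bounded:
  fixes h :: "'i \<Rightarrow> 'a::{real_normed_vector, complete_space}" and g :: "'i \<Rightarrow> real"
  assumes g: "g summable_on I" and B: "B > 0"
    and bound: "\<And>F. finite F \<Longrightarrow> F \<subseteq> I \<Longrightarrow> (norm (sum h F))\<^sup>2 \<le> B * sum g F"
  shows "h summable_on I"
proof -
  have "\<exists>P. eventually P (finite_subsets_at_top I) \<and>
      (\<forall>F F'. P F \<and> P F' \<longrightarrow> dist (sum h F) (sum h F') < e)" if "e > 0" for e
  proof -
    \<comment> \<open>If two scalar partial sums lie within \<open>d\<close> of the limit, they
      differ by less than \<open>2 * d\<close>, and \<open>B * (2 * d) = (e / 3)\<^sup>2\<close>.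
      Comparing two vector partial sums through \<open>F0\<close> then costs at most
      \<open>2 * e / 3 < e\<close>.\<close>
    define d where "d = (e / 3)\<^sup>2 / B / 2"
    have "d > 0"
      using that B by (simp add: d_def)
    have "(sum g \<longlongrightarrow> infsum g I) (finite_subsets_at_top I)"
      using g by (metis has_sum_def has_sum_infsum)
    then have "\<forall>\<^sub>F F in finite_subsets_at_top I. dist (sum g F) (infsum g I) < d"
      using \<open>d > 0\<close> by (rule tendstoD)
    then obtain F0 where F0: "finite F0" "F0 \<subseteq> I"
      and near: "\<And>F. finite F \<Longrightarrow> F0 \<subseteq> F \<Longrightarrow> F \<subseteq> I \<Longrightarrow> dist (sum g F) (infsum g I) < d"
      by (auto simp: eventually_finite_subsets_at_top)
    have close: "dist (sum h F) (sum h F0) \<le> e / 3" if F: "finite F" "F0 \<subseteq> F" "F \<subseteq> I" for F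
    proof -
      have "(norm (sum h F - sum h F0))\<^sup>2 \<le> B * (sum g F - sum g F0)"
        using bound[of "F - F0"] F F0 by (simp add: sum_diff subset_iff)
      also have "\<dots> \<le> B * (2 * d)"
        using near[OF F] near[of F0] F0 B by (intro mult_left_mono) (auto simp: dist_real_def)
      also have "\<dots> = (e / 3)\<^sup>2"
        using B by (simp add: d_def)
      finally show ?thesis
        using \<open>e > 0\<close> by (simp add: dist_norm abs_le_square_iff[symmetric])
    qed
    have "dist (sum h F) (sum h F') < e"
      if "finite F" "F0 \<subseteq> F" "F \<subseteq> I" "finite F'" "F0 \<subseteq> F'" "F' \<subseteq> I" for F F'
      using close[of F] close[of F'] that \<open>e > 0\<close>
        dist_triangle2[of "sum h F" "sum h F'" "sum h F0"] by auto
    then show ?thesis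
      using F0
      by (intro exI[where x = "\<lambda>F. finite F \<and> F0 \<subseteq> F \<and> F \<subseteq> I"])
        (auto simp: eventually_finite_subsets_at_top)
  qed
  then have "cauchy_filter (filtermap (sum h) (finite_subsets_at_top I))"
    by (simp add: cauchy_filter_metric_filtermap)
  then obtain z where "(sum h \<longlongrightarrow> z) (finite_subsets_at_top I)"
    using complete_uniform[where S = "UNIV :: 'a set"] complete_UNIV
    by (force simp: filterlim_def)
  then show ?thesis
    by (auto simp: summable_on_def has_sum_def)
qed

lemma has_sum_square_bounded:
  fixes h :: "'i \<Rightarrow> 'a::real_normed_vector" and g :: "'i \<Rightarrow> real"
  assumes "(h has_sum z) I" and "(g has_sum s) I"
    and "\<And>F. finite F \<Longrightarrow> F \<subseteq> I \<Longrightarrow> (norm (sum h F))\<^sup>2 \<le> B * sum g F"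
  shows "(norm z)\<^sup>2 \<le> B * s"
proof (rule tendsto_le)
  show "((\<lambda>F. B * sum g F) \<longlongrightarrow> B * s) (finite_subsets_at_top I)"
    using assms(2) by (auto simp: has_sum_def intro: tendsto_intros)
  show "((\<lambda>F. (norm (sum h F))\<^sup>2) \<longlongrightarrow> (norm z)\<^sup>2) (finite_subsets_at_top I)"
    using assms(1) by (auto simp: has_sum_def intro: tendsto_intros)
  show "\<forall>\<^sub>F F in finite_subsets_at_top I. (norm (sum h F))\<^sup>2 \<le> B * sum g F"
    using assms(3) by (rule eventually_finite_subsets_at_top_weakI)
qed simp


section \<open>Frames of closed subspaces\<close>

text \<open>An abstract \<open>K\<close> lets one theory serve both cases: the closed span of the
  frame sequence \<open>w\<close>, and the whole space with \<open>A = B = 1\<close> for a Parseval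
  frame.\<close>

locale closed_subspace_frame =
  fixes I :: "'i set" and w :: "'i \<Rightarrow> 'a::chilbert_space" and K :: "'a set" and A B :: real
  assumes frame: "frame_with_bounds I w K A B"
    and closed_K: "closed K"
    and zero_mem: "0 \<in> K"
    and add_mem: "x \<in> K \<Longrightarrow> y \<in> K \<Longrightarrow> x + y \<in> K"
    and scaleC_mem: "x \<in> K \<Longrightarrow> c *\<^sub>C x \<in> K"
begin

abbreviation S :: "'a \<Rightarrow> 'a" where "S \<equiv> frame_operator I w"

abbreviation energy :: "'a \<Rightarrow> real"
  where "energy x \<equiv> \<Sum>\<^sub>\<infinity>i\<in>I. (cmod (cinner x (w i)))\<^sup>2"

lemma bounds: "0 < A" "A \<le> B" "0 < B"
  and w_mem: "i \<in> I \<Longrightarrow> w i \<in> K"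
  and energy_lower: "x \<in> K \<Longrightarrow> A * (norm x)\<^sup>2 \<le> energy x"
  and energy_upper: "x \<in> K \<Longrightarrow> energy x \<le> B * (norm x)\<^sup>2"
  and coeffs_summable_mem: "x \<in> K \<Longrightarrow> (\<lambda>i. (cmod (cinner x (w i)))\<^sup>2) summable_on I"
  using frame by (auto simp: frame_with_bounds_def)

lemma scaleR_mem: "x \<in> K \<Longrightarrow> r *\<^sub>R x \<in> K"
  by (simp add: scaleC_of_real[symmetric] scaleC_mem)

lemma diff_mem: "x \<in> K \<Longrightarrow> y \<in> K \<Longrightarrow> x - y \<in> K"
  using add_mem[of x "- y"] scaleR_mem[of y "-1"] by simp

lemma sum_mem: "(\<And>i. i \<in> F \<Longrightarrow> h i \<in> K) \<Longrightarrow> sum h F \<in> K"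
  by (induction F rule: infinite_finite_induct) (auto simp: zero_mem add_mem)

text \<open>Let \<open>z\<close> be the finite sum and \<open>s\<close> the sum of the squared
  coefficients. Expanding one argument of <z, z> and applying Cauchy-Schwarz for finite sums and the
  upper frame bound at \<open>z\<close>, which lies in \<open>K\<close>, gives |z|^4 <= s B |z|^2. A
  factor |z|^2 cancels unless \<open>z = 0\<close>.\<close>

lemma synthesis_bound:
  assumes "finite F" and "F \<subseteq> I"
  shows "(norm (\<Sum>i\<in>F. c i *\<^sub>C w i))\<^sup>2 \<le> B * (\<Sum>i\<in>F. (cmod (c i))\<^sup>2)"
proof -
  define z where "z = (\<Sum>i\<in>F. c i *\<^sub>C w i)"
  define s where "s = (\<Sum>i\<in>F. (cmod (c i))\<^sup>2)"
  have z: "z \<in> K"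
    using assms unfolding z_def by (intro sum_mem scaleC_mem w_mem) auto
  have "(norm z)\<^sup>2 = cmod (cinner z z)"
    by (simp add: cinner_self norm_power)
  also have "\<dots> = cmod (\<Sum>i\<in>F. c i * cinner (w i) z)"
    by (subst (1) z_def) (simp add: cinner_sum_left cinner_scaleC_left)
  also have "\<dots> \<le> (\<Sum>i\<in>F. \<bar>cmod (c i)\<bar> * \<bar>cmod (cinner z (w i))\<bar>)"
    by (rule sum_norm_le) (simp add: norm_mult cmod_cinner_commute)
  also have "\<dots> \<le> L2_set (\<lambda>i. cmod (c i)) F * L2_set (\<lambda>i. cmod (cinner z (w i))) F"
    by (rule L2_set_mult_ineq)
  finally have "((norm z)\<^sup>2)\<^sup>2 \<le>
      (L2_set (\<lambda>i. cmod (c i)) F * L2_set (\<lambda>i. cmod (cinner z (w i))) F)\<^sup>2"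
    by (intro power_mono) auto
  also have "\<dots> = s * (\<Sum>i\<in>F. (cmod (cinner z (w i)))\<^sup>2)"
    by (simp add: power_mult_distrib L2_set_def sum_nonneg s_def)
  also have "\<dots> \<le> s * (B * (norm z)\<^sup>2)"
  proof (rule mult_left_mono)
    have "(\<Sum>i\<in>F. (cmod (cinner z (w i)))\<^sup>2) \<le> energy z"
      using assms coeffs_summable_mem[OF z] by (intro finite_sum_le_infsum) auto
    then show "(\<Sum>i\<in>F. (cmod (cinner z (w i)))\<^sup>2) \<le> B * (norm z)\<^sup>2"
      using energy_upper[OF z] by simp
  qed (simp add: s_def sum_nonneg)
  finally have "(norm z)\<^sup>2 * (norm z)\<^sup>2 \<le> (B * s) * (norm z)\<^sup>2"
    by (simp add: power2_eq_square mult_ac)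
  then have "z \<noteq> 0 \<Longrightarrow> (norm z)\<^sup>2 \<le> B * s"
    by (rule mult_right_le_imp_le) simp
  moreover have "0 \<le> B * s"
    using bounds(3) by (simp add: s_def sum_nonneg)
  ultimately have "(norm z)\<^sup>2 \<le> B * s"
    by (cases "z = 0") simp_all
  then show ?thesis
    by (simp add: z_def s_def)
qed

text \<open>The vector \<open>x\<close> is arbitrary because the frame operator is later applied to
  \<open>v i\<close>, which may lie outside \<open>K\<close>. The bound follows from
  \<open>synthesis_bound\<close> by duality: for \<open>z\<close> synthesized from the coefficients
  of \<open>x\<close> itself, <z, x> equals the partial sum \<open>s\<close>, so s^2 <= |z|^2 |x|^2
  <= B s |x|^2.\<close>

lemma coeffs_summable: "(\<lambda>i. (cmod (cinner x (w i)))\<^sup>2) summable_on I"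
proof (rule nonneg_bdd_above_summable_on)
  have "(\<Sum>i\<in>F. (cmod (cinner x (w i)))\<^sup>2) \<le> B * (norm x)\<^sup>2" if F: "finite F" "F \<subseteq> I" for F
  proof -
    define s where "s = (\<Sum>i\<in>F. (cmod (cinner x (w i)))\<^sup>2)"
    define z where "z = (\<Sum>i\<in>F. cinner x (w i) *\<^sub>C w i)"
    have "cinner z x = (\<Sum>i\<in>F. cinner x (w i) * cnj (cinner x (w i)))"
      unfolding z_def cinner_sum_left cinner_scaleC_left
      by (intro sum.cong refl arg_cong2[where f = "(*)"] cinner_commute)
    also have "\<dots> = complex_of_real s"
      unfolding s_def of_real_sum complex_norm_square ..
    finally have "\<bar>s\<bar> \<le> norm z * norm x"
      using cinner_Cauchy_Schwarz[of z x] by simp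
    then have "\<bar>s\<bar>\<^sup>2 \<le> (norm z)\<^sup>2 * (norm x)\<^sup>2"
      unfolding power_mult_distrib[symmetric] by (intro power_mono) auto
    also have "\<dots> \<le> (B * s) * (norm x)\<^sup>2"
      unfolding z_def s_def by (intro mult_right_mono synthesis_bound F) auto
    finally have "s * s \<le> s * (B * (norm x)\<^sup>2)"
      by (simp add: power2_eq_square mult_ac)
    moreover have "0 \<le> s" "0 \<le> B * (norm x)\<^sup>2"
      using bounds by (auto simp: s_def sum_nonneg)
    ultimately have "s \<le> B * (norm x)\<^sup>2"
      by (cases "s = 0") auto
    then show ?thesis
      by (simp add: s_def)
  qed
  then show "bdd_above (sum (\<lambda>i. (cmod (cinner x (w i)))\<^sup>2) ` {F. F \<subseteq> I \<and> finite F})"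
    by (intro bdd_aboveI) auto
qed simp

lemma synthesis_summable:
  assumes "(\<lambda>i. (cmod (c i))\<^sup>2) summable_on I"
  shows "(\<lambda>i. c i *\<^sub>C w i) summable_on I"
  using assms bounds(3) synthesis_bound by (rule summable_on_square_bounded)

lemma synthesis_mem:
  assumes "((\<lambda>i. c i *\<^sub>C w i) has_sum z) I"
  shows "z \<in> K"
proof (rule Lim_in_closed_set[OF closed_K])
  show "(sum (\<lambda>i. c i *\<^sub>C w i) \<longlongrightarrow> z) (finite_subsets_at_top I)"
    using assms by (simp add: has_sum_def)
  show "\<forall>\<^sub>F F in finite_subsets_at_top I. (\<Sum>i\<in>F. c i *\<^sub>C w i) \<in> K"
    by (rule eventually_finite_subsets_at_top_weakI) (auto intro!: sum_mem scaleC_mem w_mem)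
qed simp

section \<open>The frame operator: convergence, linearity and quadratic form\<close>

lemma frame_operator_has_sum: "((\<lambda>i. cinner x (w i) *\<^sub>C w i) has_sum S x) I"
  unfolding frame_operator_def by (intro has_sum_infsum synthesis_summable coeffs_summable)

lemma frame_operator_mem: "S x \<in> K"
  by (rule synthesis_mem[OF frame_operator_has_sum])

lemma frame_operator_eqI: "((\<lambda>i. cinner x (w i) *\<^sub>C w i) has_sum z) I \<Longrightarrow> S x = z"
  using frame_operator_has_sum has_sum_unique by blast

lemma frame_operator_add: "S (x + y) = S x + S y"
  using has_sum_add[OF frame_operator_has_sum[of x] frame_operator_has_sum[of y]]
  by (intro frame_operator_eqI) (simp add: cinner_add_left scaleC_add_left)

lemma frame_operator_scaleC: "S (c *\<^sub>C x) = c *\<^sub>C S x"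
  using has_sum_bounded_linear[OF bounded_linear_scaleC frame_operator_has_sum[of x]]
  by (intro frame_operator_eqI) (simp add: cinner_scaleC_left scaleC_scaleC)

lemma frame_operator_diff: "S (x - y) = S x - S y"
  using frame_operator_add[of x "- y"] frame_operator_scaleC[of "-1" y]
  by (simp add: scaleC_minus_one)

lemma frame_operator_sum: "S (sum h F) = (\<Sum>i\<in>F. S (h i))"
  by (induction F rule: infinite_finite_induct)
    (use frame_operator_diff[of 0 0] in \<open>auto simp: frame_operator_add\<close>)

lemma cinner_frame_operator: "cinner (S x) x = complex_of_real (energy x)"
proof -
  have "((\<lambda>i. complex_of_real ((cmod (cinner x (w i)))\<^sup>2)) has_sum cinner (S x) x) I"
    using has_sum_cinner[OF frame_operator_has_sum, of x x]
    by (simp only: complex_norm_square cinner_commute[symmetric])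
  moreover have "((\<lambda>i. complex_of_real ((cmod (cinner x (w i)))\<^sup>2)) has_sum
      complex_of_real (energy x)) I"
    by (intro has_sum_of_real has_sum_infsum coeffs_summable)
  ultimately show ?thesis
    by (rule has_sum_unique)
qed

lemma norm_frame_operator: "(norm (S x))\<^sup>2 \<le> B * energy x"
  using frame_operator_has_sum has_sum_infsum[OF coeffs_summable] synthesis_bound
  by (rule has_sum_square_bounded)

text \<open>\<open>\<parallel>S x\<parallel>\<^sup>2 \<le> B \<langle>S x, x\<rangle>\<close> absorbs the quadratic term of \<open>\<parallel>x - B\<^sup>-\<^sup>1 S x\<parallel>\<^sup>2\<close>.\<close>

lemma frame_operator_contraction:
  assumes "x \<in> K"
  shows "(norm (x - (1 / B) *\<^sub>R S x))\<^sup>2 \<le> (1 - A / B) * (norm x)\<^sup>2"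
proof -
  have "Re (cinner x (S x)) = energy x"
    using cinner_frame_operator[of x] cinner_commute[of x "S x"] by simp
  then have "(norm (x - (1 / B) *\<^sub>R S x))\<^sup>2 =
      (norm x)\<^sup>2 - 2 * (energy x / B) + (norm (S x))\<^sup>2 / B\<^sup>2"
    by (simp add: norm_diff_square cinner_scaleR_right power_divide)
  also have "(norm (S x))\<^sup>2 / B\<^sup>2 \<le> B * energy x / B\<^sup>2"
    by (intro divide_right_mono norm_frame_operator) simp
  also have "B * energy x / B\<^sup>2 = energy x / B"
    by (simp add: power2_eq_square)
  also have "(norm x)\<^sup>2 - 2 * (energy x / B) + energy x / B \<le> (norm x)\<^sup>2 - A * (norm x)\<^sup>2 / B"
    using divide_right_mono[OF energy_lower[OF assms], of B] bounds by simp
  finally show ?thesis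
    by (simp add: algebra_simps)
qed

section \<open>Invertibility of the frame operator on \<open>K\<close>\<close>

lemma frame_operator_lower:
  assumes "x \<in> K"
  shows "A * norm x \<le> norm (S x)"
proof -
  have "A * norm x * norm x \<le> norm (S x) * norm x"
    using energy_lower[OF assms] cinner_Cauchy_Schwarz[of "S x" x]
    by (simp add: cinner_frame_operator power2_eq_square)
  then show ?thesis
    by (cases "x = 0") auto
qed

text \<open>Solving \<open>S x = z\<close> is a fixed point problem for a relaxed iteration with
  step \<open>1 / B\<close>. By \<open>frame_operator_contraction\<close> the iteration contracts,
  and Banach's theorem on the complete set \<open>K\<close> gives a solution.\<close>

lemma frame_operator_surj: "S ` K = K"
proof
  show "K \<subseteq> S ` K"
  proof
    fix z
    assume z: "z \<in> K"
    \<comment> \<open>\<open>A \<le> B\<close> makes the root real, and \<open>0 < A\<close> makes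
      it less than 1. The fixed points of \<open>T\<close> are exactly the solutions of
      \<open>S x = z\<close>.\<close>
    define q where "q = sqrt (1 - A / B)"
    define T where "T x = x - (1 / B) *\<^sub>R S x + (1 / B) *\<^sub>R z" for x
    have q: "0 \<le> q" "q < 1" "q\<^sup>2 = 1 - A / B"
      using bounds by (auto simp: q_def)
    have "\<exists>!x\<in>K. T x = x"
    proof (rule Banach_fix)
      show "complete K"
        using closed_K complete_UNIV by (metis complete_Int_closed inf_top_left)
      show "T ` K \<subseteq> K"
        using z by (auto simp: T_def intro!: add_mem diff_mem scaleR_mem frame_operator_mem)
      show "dist (T x) (T y) \<le> q * dist x y" if "x \<in> K" "y \<in> K" for x y
      proof -
        have "T x - T y = (x - y) - (1 / B) *\<^sub>R S (x - y)"
          by (simp add: T_def frame_operator_diff scaleR_diff_right)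
        then have "(norm (T x - T y))\<^sup>2 \<le> (q * norm (x - y))\<^sup>2"
          using frame_operator_contraction[of "x - y"] that q
          by (simp add: diff_mem power_mult_distrib)
        then show ?thesis
          unfolding dist_norm by (rule power2_le_imp_le) (simp add: q)
      qed
    qed (use q zero_mem in auto)
    then obtain x where "x \<in> K" "T x = x"
      by blast
    then have "(1 / B) *\<^sub>R S x = (1 / B) *\<^sub>R z"
      by (simp add: T_def del: scaleR_cancel_left)
    then have "S x = z"
      using bounds(3) by auto
    then show "z \<in> S ` K"
      using \<open>x \<in> K\<close> by blast
  qed
qed (auto simp: frame_operator_mem)

section \<open>The inverse frame operator and the dual sequence\<close>

abbreviation S_inv :: "'a \<Rightarrow> 'a" where "S_inv \<equiv> inv_into K S"

lemma S_inv_mem: "x \<in> K \<Longrightarrow> S_inv x \<in> K"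
  and S_S_inv: "x \<in> K \<Longrightarrow> S (S_inv x) = x"
  by (auto simp: frame_operator_surj inv_into_into f_inv_into_f)

text \<open>The inverse is bounded, by \<open>frame_operator_lower\<close>, so it may be applied to
  a convergent series term by term.\<close>

lemma dual_synthesis:
  assumes "((\<lambda>i. c i *\<^sub>C w i) has_sum z) I"
  shows "((\<lambda>i. c i *\<^sub>C S_inv (w i)) has_sum S_inv z) I"
proof -
  have z: "z \<in> K"
    using assms by (rule synthesis_mem)
  have bound: "norm ((\<Sum>i\<in>F. c i *\<^sub>C S_inv (w i)) - S_inv z) \<le>
      norm ((\<Sum>i\<in>F. c i *\<^sub>C w i) - z) / A" if "F \<subseteq> I" for F
  proof -
    \<comment> \<open>\<open>S\<close> carries the error of the dual partial sum to the error of the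
      original one, so the lower bound controls the former by the latter divided by
      \<open>A\<close>. Linearity is thus taken from \<open>S\<close> rather than from
      \<open>S_inv\<close>.\<close>
    have "S ((\<Sum>i\<in>F. c i *\<^sub>C S_inv (w i)) - S_inv z) = (\<Sum>i\<in>F. c i *\<^sub>C w i) - z"
      using that z
      by (auto simp: frame_operator_diff frame_operator_sum frame_operator_scaleC S_S_inv w_mem
          intro!: sum.cong)
    moreover have "(\<Sum>i\<in>F. c i *\<^sub>C S_inv (w i)) - S_inv z \<in> K"
      using that z by (auto intro!: diff_mem sum_mem scaleC_mem S_inv_mem w_mem)
    ultimately show ?thesis
      using frame_operator_lower bounds by (metis mult.commute pos_le_divide_eq)
  qed
  have "((\<lambda>F. norm ((\<Sum>i\<in>F. c i *\<^sub>C w i) - z) / A) \<longlongrightarrow> 0) (finite_subsets_at_top I)"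
    using assms unfolding has_sum_def
    by (intro tendsto_divide_zero tendsto_norm_zero) (simp add: Lim_null[symmetric])
  moreover have "\<forall>\<^sub>F F in finite_subsets_at_top I.
      norm ((\<Sum>i\<in>F. c i *\<^sub>C S_inv (w i)) - S_inv z) \<le> norm ((\<Sum>i\<in>F. c i *\<^sub>C w i) - z) / A"
    using bound by (intro eventually_finite_subsets_at_top_weakI) auto
  ultimately have "((\<lambda>F. (\<Sum>i\<in>F. c i *\<^sub>C S_inv (w i)) - S_inv z) \<longlongrightarrow> 0)
      (finite_subsets_at_top I)"
    by (rule Lim_null_comparison[rotated])
  then show ?thesis
    by (simp add: has_sum_def Lim_null[symmetric])
qed

lemma dual_summable:
  assumes "(\<lambda>i. (cmod (c i))\<^sup>2) summable_on I"
  shows "(\<lambda>i. c i *\<^sub>C S_inv (w i)) summable_on I"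
proof -
  obtain z where "((\<lambda>i. c i *\<^sub>C w i) has_sum z) I"
    using synthesis_summable[OF assms] unfolding summable_on_def ..
  then show ?thesis
    using dual_synthesis unfolding summable_on_def by blast
qed

text \<open>
  \<open>S\<^sup>-\<^sup>1 S\<close> is the orthogonal projection onto \<open>K\<close>: the energy of \<open>x - S\<^sup>-\<^sup>1 S x\<close> is
  \<open>\<langle>S (x - S\<^sup>-\<^sup>1 S x), x - S\<^sup>-\<^sup>1 S x\<rangle> = 0\<close>.
\<close>

lemma cinner_S_inv_S:
  assumes "j \<in> I"
  shows "cinner (S_inv (S x)) (w j) = cinner x (w j)"
proof -
  define d where "d = x - S_inv (S x)"
  have "S d = 0"
    by (simp add: d_def frame_operator_diff S_S_inv frame_operator_mem)
  then have "energy d = 0"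
    using cinner_frame_operator[of d] by simp
  then have "(cmod (cinner d (w j)))\<^sup>2 = 0"
    using assms coeffs_summable[of d] by (intro nonneg_infsum_le_0D) auto
  then show ?thesis
    by (simp add: d_def cinner_diff_left)
qed

end

lemma frame_sequence_imp_closed_subspace_frame:
  assumes "frame_sequence I w"
  obtains A B where "closed_subspace_frame I w (closed_cspan (w ` I)) A B"
proof -
  obtain A B where "frame_with_bounds I w (closed_cspan (w ` I)) A B"
    using assms by (auto simp: frame_sequence_def frame_for_def)
  moreover have "0 \<in> closed_cspan (w ` I)"
    unfolding closed_cspan_def by (rule subsetD[OF closure_subset complex_vector.span_zero])
  ultimately show thesis
    by (intro that[of A B] closed_subspace_frame.intro closed_cspan_add closed_cspan_scaleC)
      (auto simp: closed_cspan_def)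
qed

text \<open>For \<open>A = B = 1\<close> the factor \<open>1 - A / B\<close> in
  \<open>frame_operator_contraction\<close> vanishes, so the frame operator is the identity.\<close>

lemma parseval_reconstruction:
  fixes v :: "'i \<Rightarrow> 'a::chilbert_space"
  assumes "parseval_frame_for I v UNIV"
  shows "((\<lambda>i. cinner x (v i) *\<^sub>C v i) has_sum x) I"
proof -
  interpret closed_subspace_frame I v UNIV 1 1
    using assms by unfold_locales (auto simp: parseval_frame_for_def)
  have "S x = x"
    using frame_operator_contraction[of x] by simp
  then show ?thesis
    using frame_operator_has_sum[of x] by simp
qed


section \<open>Weak R-duals\<close>

lemma has_sum_single:
  fixes c :: "'i \<Rightarrow> complex"
  assumes "i \<in> I"
  shows "((\<lambda>k. (if i = k then 1 else 0) * c k) has_sum c i) I"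
  by (rule has_sum_finite_neutralI[where B = "{i}"]) (use assms in auto)

text \<open>Adding or subtracting the one-term series of the identity matrix moves it across the
  equation. With \<open>g = h = v\<close> this rewrites the Gram condition of a weak R-dual; with
  the canonical dual and \<open>w\<close> it rewrites condition (i).\<close>

lemma gram_eq_zero_iff:
  "mat_prod_eq_zero I (mat_diff (mat_transpose (cross_gram g h)) mat_id) (cross_gram p q) \<longleftrightarrow>
    (\<forall>i\<in>I. \<forall>j\<in>I. ((\<lambda>k. cinner (p k) (q j) * cinner (g k) (h i)) has_sum cinner (p i) (q j)) I)"
proof -
  have "((\<lambda>k. (cinner (g k) (h i) - (if i = k then 1 else 0)) * cinner (p k) (q j)) has_sum 0) I
      \<longleftrightarrow> ((\<lambda>k. cinner (p k) (q j) * cinner (g k) (h i)) has_sum cinner (p i) (q j)) I"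
    (is "(?D has_sum 0) I \<longleftrightarrow> (?P has_sum _) I") if "i \<in> I" for i j
  proof
    let ?E = "\<lambda>k. (if i = k then 1 else 0) * cinner (p k) (q j)"
    note single = has_sum_single[OF that, of "\<lambda>k. cinner (p k) (q j)"]
    show "(?P has_sum cinner (p i) (q j)) I" if "(?D has_sum 0) I"
      using has_sum_add[OF that single] by (simp add: algebra_simps)
    show "(?D has_sum 0) I" if "(?P has_sum cinner (p i) (q j)) I"
      using has_sum_add[OF that has_sum_uminusI[OF single]] by (simp add: algebra_simps)
  qed
  then show ?thesis
    by (simp add: mat_prod_eq_zero_def mat_diff_def mat_transpose_def mat_id_def cross_gram_def)
qed

lemma weak_R_dual_iff:
  fixes w f u v :: "'i \<Rightarrow> 'a::chilbert_space"
  assumes f: "frame_for I f UNIV"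
    and u: "parseval_frame_for I u UNIV" and v: "parseval_frame_for I v UNIV"
  shows "weak_R_dual I f u v w \<longleftrightarrow> (\<forall>i\<in>I. \<forall>j\<in>I. cinner (f i) (u j) = cinner (w j) (v i))"
proof
  assume dual: "weak_R_dual I f u v w"
  show "\<forall>i\<in>I. \<forall>j\<in>I. cinner (f i) (u j) = cinner (w j) (v i)"
  proof (intro ballI)
    fix i j
    assume "i \<in> I" "j \<in> I"
    \<comment> \<open>The same series has two values: one from the Gram condition, the other from
      pairing the series that defines \<open>w j\<close> with \<open>v i\<close>.\<close>
    then have "((\<lambda>k. cinner (f k) (u j) * cinner (v k) (v i)) has_sum cinner (f i) (u j)) I"
      "((\<lambda>k. cinner (f k) (u j) * cinner (v k) (v i)) has_sum cinner (w j) (v i)) I"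
      using dual by (auto simp: weak_R_dual_def gram_eq_zero_iff intro: has_sum_cinner)
    then show "cinner (f i) (u j) = cinner (w j) (v i)"
      by (rule has_sum_unique)
  qed
next
  assume eq: "\<forall>i\<in>I. \<forall>j\<in>I. cinner (f i) (u j) = cinner (w j) (v i)"
  have expansion: "((\<lambda>i. cinner (f i) (u j) *\<^sub>C v i) has_sum w j) I" if "j \<in> I" for j
    using parseval_reconstruction[OF v, of "w j"]
    by (rule has_sum_cong[THEN iffD1, rotated]) (use eq that in auto)
  \<comment> \<open>This is the summability clause of the frame \<open>f\<close>, evaluated at
    \<open>u j\<close>.\<close>
  have "(\<lambda>i. (cmod (cinner (f i) (u j)))\<^sup>2) summable_on I" for j
    using f by (subst cmod_cinner_commute) (auto simp: frame_for_def frame_with_bounds_def)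
  moreover have "((\<lambda>k. cinner (f k) (u j) * cinner (v k) (v i)) has_sum cinner (f i) (u j)) I"
    if "i \<in> I" "j \<in> I" for i j
    using has_sum_cinner[OF expansion, of j "v i"] eq that by simp
  ultimately show "weak_R_dual I f u v w"
    using u v expansion by (simp add: weak_R_dual_def gram_eq_zero_iff)
qed

theorem theorem2p3:
  fixes I :: "'i set"
    and w f u v y :: "'i \<Rightarrow> 'a::chilbert_space"
  assumes "infinite_cdim TYPE('a)"
    and "separable_space (euclidean :: 'a topology)"
    and "countable I"
    and "frame_sequence I w"
    and "frame_for I f UNIV"
    and "parseval_frame_for I u UNIV"
    and "parseval_frame_for I v UNIV"
    and "\<And>i. i \<in> I \<Longrightarrow> y i = (\<Sum>\<^sub>\<infinity>k\<in>I. cinner (u k) (f i) *\<^sub>C canonical_dual I w k)"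
  shows "weak_R_dual I f u v w \<longleftrightarrow>
    mat_prod_eq_zero I
      (mat_diff (mat_transpose (cross_gram (canonical_dual I w) w)) mat_id) (cross_gram u f) \<and>
    (\<forall>i\<in>I. \<exists>x \<in> orth_compl (cspan (w ` I)). v i = y i + x)"
proof -
  obtain A B where "closed_subspace_frame I w (closed_cspan (w ` I)) A B"
    using frame_sequence_imp_closed_subspace_frame[OF assms(4)] by blast
  then interpret closed_subspace_frame I w "closed_cspan (w ` I)" A B .
  have dual: "canonical_dual I w k = S_inv (w k)" for k
    by (simp add: canonical_dual_def)
  \<comment> \<open>\<open>infsum\<close> is 0 on a divergent family, so the equation for
    \<open>y i\<close> says something only once convergence is known. The coefficients are square
    summable because \<open>u\<close> is Parseval, and \<open>dual_summable\<close> applies.\<close>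
  have y_sum: "((\<lambda>k. cinner (u k) (f i) *\<^sub>C canonical_dual I w k) has_sum y i) I" if "i \<in> I" for i
  proof -
    have "(\<lambda>k. (cmod (cinner (u k) (f i)))\<^sup>2) summable_on I"
      using assms(6)
      by (subst cmod_cinner_commute) (auto simp: parseval_frame_for_def frame_with_bounds_def)
    then have "(\<lambda>k. cinner (u k) (f i) *\<^sub>C canonical_dual I w k) summable_on I"
      unfolding dual by (rule dual_summable)
    then show ?thesis
      using assms(8)[OF that] by simp
  qed
  note y_cinner = has_sum_cinner[OF y_sum]
  let ?gram = "\<forall>j\<in>I. \<forall>i\<in>I. ((\<lambda>k. cinner (u k) (f i) * cinner (canonical_dual I w k) (w j))
    has_sum cinner (u j) (f i)) I"
  have gram_iff: "?gram \<longleftrightarrow> (\<forall>i\<in>I. \<forall>j\<in>I. cinner (y i) (w j) = cinner (u j) (f i))"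
  proof (intro iffI ballI)
    fix i j
    assume ?gram and "i \<in> I" "j \<in> I"
    then show "cinner (y i) (w j) = cinner (u j) (f i)"
      using has_sum_unique[OF y_cinner] by blast
  next
    fix j i
    assume "\<forall>i\<in>I. \<forall>j\<in>I. cinner (y i) (w j) = cinner (u j) (f i)" and "j \<in> I" "i \<in> I"
    then show "((\<lambda>k. cinner (u k) (f i) * cinner (canonical_dual I w k) (w j))
        has_sum cinner (u j) (f i)) I"
      using y_cinner[of i "w j"] by simp
  qed
  \<comment> \<open>The only possible witness is \<open>v i - y i\<close>, and orthogonality to a
    span can be tested on its generators.\<close>
  have orth_iff: "(\<exists>x \<in> orth_compl (cspan (w ` I)). v i = y i + x) \<longleftrightarrow>
      (\<forall>j\<in>I. cinner (v i) (w j) = cinner (y i) (w j))" for i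
  proof -
    have "(\<exists>x \<in> orth_compl (cspan (w ` I)). v i = y i + x) \<longleftrightarrow>
        v i - y i \<in> orth_compl (cspan (w ` I))"
      by (auto simp: algebra_simps intro!: bexI[where x = "v i - y i"])
    then show ?thesis
      by (simp add: orth_compl_cspan cinner_diff_left)
  qed
  \<comment> \<open>Under \<open>eq\<close> the coefficients of \<open>y i\<close> are those of
    \<open>S (v i)\<close>, so \<open>y i\<close> is \<open>S_inv (S (v i))\<close>, which has the
    same inner products with each \<open>w j\<close> as \<open>v i\<close>.\<close>
  have projection: "cinner (y i) (w j) = cinner (v i) (w j)"
    if eq: "\<forall>k\<in>I. cinner (v i) (w k) = cinner (u k) (f i)" and "i \<in> I" "j \<in> I" for i j
  proof -
    have "((\<lambda>k. cinner (u k) (f i) *\<^sub>C canonical_dual I w k) has_sum S_inv (S (v i))) I"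
      using dual_synthesis[OF frame_operator_has_sum[of "v i"]]
      by (rule has_sum_cong[THEN iffD1, rotated]) (simp add: eq dual)
    then have "y i = S_inv (S (v i))"
      using y_sum \<open>i \<in> I\<close> has_sum_unique by blast
    then show ?thesis
      using \<open>j \<in> I\<close> by (simp add: cinner_S_inv_S)
  qed
  have "cinner (f i) (u j) = cinner (w j) (v i) \<longleftrightarrow> cinner (v i) (w j) = cinner (u j) (f i)" for i j
    by (metis cinner_commute)
  then have "weak_R_dual I f u v w \<longleftrightarrow>
      (\<forall>i\<in>I. \<forall>j\<in>I. cinner (v i) (w j) = cinner (u j) (f i))"
    by (simp add: weak_R_dual_iff[OF assms(5-7)])
  also have "\<dots> \<longleftrightarrow> ?gram \<and> (\<forall>i\<in>I. \<exists>x \<in> orth_compl (cspan (w ` I)). v i = y i + x)"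
    \<comment> \<open>Condition (i) equates <y_i, w_j> with <u_j, f_i>, and (ii) equates it with
      <v_i, w_j>. Together they give the identities on the left. Conversely, those identities give
      (ii) by \<open>projection\<close>, and then (i) by transitivity.\<close>
    unfolding gram_iff orth_iff using projection by metis
  finally show ?thesis
    unfolding gram_eq_zero_iff .
qed

end
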